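(* Assume the following uniform Hardy–Littlewood prime pairs hypothesis: as $x\to\infty$, $$\pi_d(x):=\#\{p\le x:\ p+d \text{ is prime}\}=\mathfrak{S}(d)\frac{x}{(\log x)^2}\left(1+o\!\left(\frac{1}{(\log\log x)^2}\right)\right)$$ uniformly for all even $d$ with $2\le d\le x$. Then for all sufficiently large $N$, $$|\mathcal{R}(N)|\ge\left(\frac{1}{\log 2+2\Phi(N)}+o(1)\right)N,$$ where $\mathcal{R}(N):=\{n\le N:\ n=m+k \text{ and } 2^k+m \text{ is prime for some integers } k\ge1,\ m\ge1\}$.
   Context: $p$ denotes a prime. For even $d$, $\mathfrak{S}(d):=2C_2\prod_{p\mid d,\ p>2}\left(1+\frac{1}{p-2}\right)$ with $C_2=\prod_{p\ge3}\left(1-\frac{1}{(p-1)^2}\right)$. Let $K=K(N):=\lfloor \log_2 N - 2\log_2(\log N)\rfloor$, $d(k_2,h):=2^{k_2}(2^h-1)-h$, and $$\Phi(N):=\frac{1}{K^2}\sum_{\substack{1\le h\le K-1\\ h\equiv 0 \bmod 2}}\ \sum_{1\le k_2\le K-h}\mathfrak{S}\bigl(d(k_2,h)\bigr).$$ The $o(1)$ is as $N\to\infty$. *)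

theory Defs
  imports
    "HOL-Analysis.Analysis"
    "HOL-Computational_Algebra.Primes"
    "HOL-Library.Landau_Symbols"
begin

definition twin_prime_const :: real where
  "twin_prime_const =
     (\<Prod>p. if prime p \<and> p \<ge> 3 then 1 - 1 / (real p - 1)\<^sup>2 else 1)"

lemma convergent_prod_twin_prime_const:
  "convergent_prod (\<lambda>p. if prime p \<and> p \<ge> 3 then 1 - 1 / (real p - 1)\<^sup>2 else 1)"
proof -
  have "summable (\<lambda>n. inverse (real (Suc n) ^ 2))"
    by (subst summable_Suc_iff) (rule inverse_power_summable, simp)
  hence "summable (\<lambda>n. 1 / (real (n + 2) - 1)\<^sup>2)"
    by (simp add: field_simps)
  hence "summable (\<lambda>n. 1 / (real n - 1)\<^sup>2)"
    by (subst (asm) summable_iff_shift)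
  hence "summable (\<lambda>p. norm ((if prime p \<and> p \<ge> 3 then 1 - 1 / (real p - 1)\<^sup>2 else 1) - 1))"
    by (rule summable_comparison_test[rotated]) (auto intro!: exI[of _ 0])
  thus ?thesis
    by (intro abs_convergent_prod_imp_convergent_prod summable_imp_abs_convergent_prod)
qed

text \<open>Only meant for even \<open>d > 0\<close>; for \<open>d = 0\<close> the index set of the product is infinite.\<close>

definition singular_series :: "nat \<Rightarrow> real" where
  "singular_series d =
     2 * twin_prime_const * (\<Prod>p | prime p \<and> p dvd d \<and> p > 2. 1 + 1 / (real p - 2))"

definition prime_pairs_count :: "nat \<Rightarrow> real \<Rightarrow> nat" where
  "prime_pairs_count d x = card {p::nat. prime p \<and> real p \<le> x \<and> prime (p + d)}"

text \<open>Uniformity in \<open>d\<close>: the relative error \<open>\<theta>\<close> may depend on \<open>d\<close> and \<open>x\<close>, but is bounded by a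
  single function \<open>\<eta>\<close> of \<open>x\<close> alone.\<close>

definition uniform_prime_pairs_hypothesis :: bool where
  "uniform_prime_pairs_hypothesis \<longleftrightarrow>
     (\<exists>\<eta> \<in> o[at_top](\<lambda>x::real. 1 / (ln (ln x))\<^sup>2).
        \<forall>\<^sub>F x in at_top. \<forall>d::nat. even d \<and> 2 \<le> d \<and> real d \<le> x \<longrightarrow>
          (\<exists>\<theta>::real. \<bar>\<theta>\<bar> \<le> \<eta> x \<and>
             real (prime_pairs_count d x) = singular_series d * (x / (ln x)\<^sup>2) * (1 + \<theta>)))"

text \<open>The floor is nonnegative for all large \<open>N\<close>, so \<open>nat\<close> has no effect asymptotically.\<close>

definition K :: "nat \<Rightarrow> nat" where
  "K N = nat \<lfloor>log 2 (real N) - 2 * log 2 (ln (real N))\<rfloor>"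

definition d_diff :: "nat \<Rightarrow> nat \<Rightarrow> nat" where
  "d_diff k\<^sub>2 h = 2 ^ k\<^sub>2 * (2 ^ h - 1) - h"

lemma int_d_diff: "int (d_diff k\<^sub>2 h) = 2 ^ k\<^sub>2 * (2 ^ h - 1) - int h"
proof -
  have "h < 2 ^ h" by (rule less_exp)
  hence "h \<le> 2 ^ h - 1" by linarith
  also have "\<dots> \<le> 2 ^ k\<^sub>2 * (2 ^ h - 1)" by simp
  finally show ?thesis by (simp add: d_diff_def of_nat_diff)
qed

definition Phi :: "nat \<Rightarrow> real" where
  "Phi N = 1 / (real (K N))\<^sup>2 *
     (\<Sum>h | 1 \<le> h \<and> h \<le> K N - 1 \<and> even h.
        \<Sum>k\<^sub>2 = 1..K N - h. singular_series (d_diff k\<^sub>2 h))"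

definition R :: "nat \<Rightarrow> nat set" where
  "R N = {n. n \<le> N \<and> (\<exists>k m::nat. k \<ge> 1 \<and> m \<ge> 1 \<and> n = m + k \<and> prime (2 ^ k + m))}"

end

theory Submission
  imports Defs "HOL-Real_Asymp.Real_Asymp"
begin

text \<open>
  Let \<open>r(n)\<close> be the number of \<open>k \<le> K(N)\<close> with \<open>k < n\<close> for which \<open>2\<^sup>k + n - k\<close> is prime. By
  Cauchy--Schwarz, \<open>|R(N)| \<ge> (\<Sum> r)\<^sup>2 / \<Sum> r\<^sup>2\<close>. The off-diagonal part of \<open>\<Sum> r\<^sup>2\<close> counts prime pairs
  with differences \<open>d(k\<^sub>2, h)\<close>, so the hypothesis bounds it by
  \<open>(2 \<Phi>(N) / (log 2)\<^sup>2 + o(1) \<Phi>(N)) N\<close>; for odd \<open>h\<close> it is empty by parity.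

  The first moment needs \<open>\<pi>(N) \<ge> (1 - o(1)) N / log N\<close>. This follows from the hypothesis itself: the
  square of the number of primes in \<open>(x, 2x]\<close> is at least twice the number of prime pairs in that
  interval, which is \<open>\<Sum>\<^sub>d (\<pi>\<^sub>d(2x - d) - \<pi>\<^sub>d(x))\<close>, and the singular series has mean value at least 1
  over the integers (counting odd \<open>d\<close> as 0), because the Euler product of its mean over any finite set
  of primes cancels the corresponding factors of \<open>C\<^sub>2\<close>. Summing over dyadic intervals gives the bound.
\<close>

section \<open>The mean value of the singular series\<close>

lemma twin_prime_factor_pos:
  fixes p :: nat assumes "p > 2" shows "1 - 1 / (real p - 1)\<^sup>2 > 0"
proof -
  have "2\<^sup>2 \<le> (real p - 1)\<^sup>2"
    using assms by (intro power_mono) auto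
  thus ?thesis
    by (simp add: divide_simps)
qed

lemma twin_prime_const_pos: "twin_prime_const > 0"
  unfolding twin_prime_const_def
proof (rule less_0_prodinf[OF convergent_prod_twin_prime_const])
  show "0 < (if prime p \<and> p \<ge> 3 then 1 - 1 / (real p - 1)\<^sup>2 else 1)" for p :: nat
    using twin_prime_factor_pos[of p] by (cases "p \<ge> 3") auto
qed

lemma twin_prime_const_LIMSEQ:
  "(\<lambda>M. \<Prod>p | prime p \<and> 2 < p \<and> p \<le> M. 1 - 1 / (real p - 1)\<^sup>2) \<longlonglongrightarrow> twin_prime_const"
proof -
  have "(\<Prod>p\<le>M. if prime p \<and> p \<ge> 3 then 1 - 1 / (real p - 1)\<^sup>2 else 1) =
        (\<Prod>p | prime p \<and> 2 < p \<and> p \<le> M. 1 - 1 / (real p - 1)\<^sup>2)" for M :: nat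
    by (rule prod.mono_neutral_cong_right) auto
  with convergent_prod_LIMSEQ[OF convergent_prod_twin_prime_const] show ?thesis
    unfolding twin_prime_const_def by simp
qed

lemma singular_series_nonneg: "singular_series d \<ge> 0"
  unfolding singular_series_def using twin_prime_const_pos
  by (intro mult_nonneg_nonneg prod_nonneg) auto

text \<open>Every factor of the singular series exceeds 1, so omitting the primes outside
  \<open>P\<close> can only lower it. The shape "term plus 1" prepares the expansion by
  \<open>prod_add\<close>.\<close>

lemma singular_series_ge_restricted:
  assumes "d > 0" "finite P" and P: "\<And>p. p \<in> P \<Longrightarrow> prime p \<and> p > 2"
  shows "2 * twin_prime_const * (\<Prod>p\<in>P. (if p dvd d then 1 / (real p - 2) else 0) + 1)
           \<le> singular_series d"
proof -
  have fin: "finite {p. prime p \<and> p dvd d \<and> p > 2}"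
    by (rule finite_subset[of _ "{..d}"]) (use \<open>d > 0\<close> in \<open>auto dest: dvd_imp_le\<close>)
  have "(\<Prod>p\<in>P. (if p dvd d then 1 / (real p - 2) else 0) + 1) =
        (\<Prod>p\<in>{p\<in>P. p dvd d}. 1 + 1 / (real p - 2))"
    by (rule prod.mono_neutral_cong_right) (use \<open>finite P\<close> in auto)
  also have "\<dots> \<le> (\<Prod>p | prime p \<and> p dvd d \<and> p > 2. 1 + 1 / (real p - 2))"
  proof (rule prod_mono2[OF fin])
    show "{p\<in>P. p dvd d} \<subseteq> {p. prime p \<and> p dvd d \<and> p > 2}" using P by blast
    show "0 \<le> 1 + 1 / (real p - 2)" if "p \<in> {p\<in>P. p dvd d}" for p
      using P[of p] that by simp
  qed auto
  finally show ?thesis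
    unfolding singular_series_def using twin_prime_const_pos
    by (intro mult_left_mono) auto
qed

text \<open>Only the multiples of \<open>2 * m\<close> are used; rounding \<open>y / (2 * m)\<close>
  down loses less than 1.\<close>

lemma card_even_multiples_ge:
  fixes m y :: nat
  assumes "m > 0"
  shows "real (card {d\<in>{1..y}. even d \<and> m dvd d}) \<ge> real y / (2 * real m) - 1"
proof -
  have "(\<lambda>i. 2 * m * i) ` {1..y div (2 * m)} \<subseteq> {d\<in>{1..y}. even d \<and> m dvd d}"
  proof (intro image_subsetI)
    fix i assume i: "i \<in> {1..y div (2 * m)}"
    hence "2 * m * i \<le> 2 * m * (y div (2 * m))"
      by (intro mult_left_mono) auto
    also have "\<dots> \<le> y" by simp
    finally show "2 * m * i \<in> {d\<in>{1..y}. even d \<and> m dvd d}"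
      using i \<open>m > 0\<close> by auto
  qed
  hence "card ((\<lambda>i. 2 * m * i) ` {1..y div (2 * m)}) \<le> card {d\<in>{1..y}. even d \<and> m dvd d}"
    by (intro card_mono) auto
  also have "card ((\<lambda>i. 2 * m * i) ` {1..y div (2 * m)}) = y div (2 * m)"
    using \<open>m > 0\<close> by (subst card_image) (auto simp: inj_on_def)
  finally have "real (y div (2 * m)) \<le> real (card {d\<in>{1..y}. even d \<and> m dvd d})"
    by simp
  moreover have "real y / real (2 * m) - 1 \<le> real (y div (2 * m))"
    using floor_divide_of_nat_eq[of y "2 * m", where 'a = real] by linarith
  ultimately show ?thesis by simp
qed

definition even_singular_sum :: "nat \<Rightarrow> real" where
  "even_singular_sum y = (\<Sum>d | d \<in> {1..y} \<and> even d. singular_series d)"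

text \<open>Expanding the product over \<open>P\<close> into subsets \<open>A\<close> gives a
  divisor sum with weights \<open>g A\<close>. After summing over even \<open>d\<close>, the
  densities recombine into the Euler product, while the rounding errors add up to a constant
  depending only on \<open>P\<close>.\<close>

lemma even_singular_sum_ge_restricted:
  assumes "finite P" and P: "\<And>p. p \<in> P \<Longrightarrow> prime p \<and> p > 2"
  shows "\<exists>C\<ge>0. \<forall>y. even_singular_sum y \<ge>
           twin_prime_const * (\<Prod>p\<in>P. 1 / (1 - 1 / (real p - 1)\<^sup>2)) * real y - C"
proof -
  define g where "g A = (\<Prod>p\<in>A. 1 / (real p - 2))" for A :: "nat set"
  define C where "C = 2 * twin_prime_const * (\<Sum>A\<in>Pow P. g A)"
  have g_nonneg: "g A \<ge> 0" if "A \<subseteq> P" for A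
    unfolding g_def using that P by (intro prod_nonneg) force
  have C: "C \<ge> 0"
    unfolding C_def using g_nonneg twin_prime_const_pos
    by (intro mult_nonneg_nonneg sum_nonneg) auto
  have main: "even_singular_sum y \<ge>
      twin_prime_const * (\<Prod>p\<in>P. 1 / (1 - 1 / (real p - 1)\<^sup>2)) * real y - C" for y
  proof -
    let ?E = "{d. d \<in> {1..y} \<and> even d}"
    \<comment> \<open>Both factors equal \<open>(p - 1)^2 / (p * (p - 2))\<close>: the extra weight
      \<open>1 / (p - 2)\<close> is collected with density \<open>1 / p\<close>.\<close>
    have "(\<Prod>p\<in>P. 1 / (1 - 1 / (real p - 1)\<^sup>2)) = (\<Prod>p\<in>P. 1 / (real p - 2) * (1 / real p) + 1)"
    proof (rule prod.cong[OF refl])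
      fix p assume "p \<in> P"
      hence "real p > 2" using P by simp
      moreover from this have "1 - 1 / (real p - 1)\<^sup>2 = real p * (real p - 2) / (real p - 1)\<^sup>2"
        by (simp add: divide_simps) (simp add: power2_eq_square algebra_simps)
      ultimately show "1 / (1 - 1 / (real p - 1)\<^sup>2) = 1 / (real p - 2) * (1 / real p) + 1"
        by (simp add: divide_simps) (simp add: power2_eq_square algebra_simps)
    qed
    also have "\<dots> = (\<Sum>A\<in>Pow P. (\<Prod>p\<in>A. 1 / (real p - 2) * (1 / real p)) * (\<Prod>p\<in>P-A. 1))"
      by (rule prod_add[OF \<open>finite P\<close>])
    also have "\<dots> = (\<Sum>A\<in>Pow P. g A / real (\<Prod>A))"
      unfolding g_def prod.distrib of_nat_prod by (simp add: prod_dividef)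
    finally have euler: "(\<Prod>p\<in>P. 1 / (1 - 1 / (real p - 1)\<^sup>2)) = (\<Sum>A\<in>Pow P. g A / real (\<Prod>A))" .
    have "(\<Sum>A\<in>Pow P. g A * (real y / (2 * real (\<Prod>A)) - 1)) \<le>
        (\<Sum>A\<in>Pow P. g A * real (card {d\<in>{1..y}. even d \<and> \<Prod>A dvd d}))"
    proof (intro mult_left_mono sum_mono)
      fix A assume A: "A \<in> Pow P"
      have "\<Prod>A > 0" using A P by (intro prod_pos) force
      thus "real y / (2 * real (\<Prod>A)) - 1 \<le> real (card {d\<in>{1..y}. even d \<and> \<Prod>A dvd d})"
        by (rule card_even_multiples_ge)
    qed (use g_nonneg in auto)
    also have "\<dots> = (\<Sum>A\<in>Pow P. \<Sum>d\<in>?E. if \<Prod>A dvd d then g A else 0)"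
    proof (rule sum.cong[OF refl])
      fix A
      have "(\<Sum>d\<in>?E. if \<Prod>A dvd d then g A else 0) = (\<Sum>d\<in>{d\<in>?E. \<Prod>A dvd d}. g A)"
        by (rule sum.mono_neutral_cong_right) auto
      also have "{d\<in>?E. \<Prod>A dvd d} = {d\<in>{1..y}. even d \<and> \<Prod>A dvd d}" by auto
      finally show "g A * real (card {d\<in>{1..y}. even d \<and> \<Prod>A dvd d}) =
          (\<Sum>d\<in>?E. if \<Prod>A dvd d then g A else 0)" by simp
    qed
    also have "\<dots> = (\<Sum>d\<in>?E. \<Sum>A\<in>Pow P. if \<Prod>A dvd d then g A else 0)"
      by (rule sum.swap)
    \<comment> \<open>An inequality suffices: if \<open>\<Prod>A\<close> divides \<open>d\<close>,
      so does each member of \<open>A\<close>; otherwise the left side is 0. Coprimality of the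
      members never enters.\<close>
    also have "\<dots> \<le> (\<Sum>d\<in>?E. \<Sum>A\<in>Pow P. \<Prod>p\<in>A. if p dvd d then 1 / (real p - 2) else 0)"
    proof (intro sum_mono)
      fix d A assume A: "A \<in> Pow P"
      hence "finite A" using \<open>finite P\<close> finite_subset by auto
      show "(if \<Prod>A dvd d then g A else 0) \<le> (\<Prod>p\<in>A. if p dvd d then 1 / (real p - 2) else 0)"
      proof (cases "\<Prod>A dvd d")
        case True
        hence "p dvd d" if "p \<in> A" for p
          using dvd_prod_eqI[OF \<open>finite A\<close> that, of p "\<lambda>x. x"] dvd_trans by blast
        thus ?thesis using True by (simp add: g_def cong: prod.cong)
      next
        case False
        have "0 \<le> (if p dvd d then 1 / (real p - 2) else 0)" if "p \<in> A" for p
          using that A P[of p] by auto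
        hence "0 \<le> (\<Prod>p\<in>A. if p dvd d then 1 / (real p - 2) else 0)"
          by (rule prod_nonneg)
        thus ?thesis using False by simp
      qed
    qed
    also have "\<dots> = (\<Sum>d\<in>?E. \<Prod>p\<in>P. (if p dvd d then 1 / (real p - 2) else 0) + 1)"
      by (subst prod_add[OF \<open>finite P\<close>]) simp
    finally have "2 * twin_prime_const * (\<Sum>A\<in>Pow P. g A * (real y / (2 * real (\<Prod>A)) - 1)) \<le>
        2 * twin_prime_const * (\<Sum>d\<in>?E. \<Prod>p\<in>P. (if p dvd d then 1 / (real p - 2) else 0) + 1)"
      using twin_prime_const_pos by (intro mult_left_mono) auto
    also have "\<dots> \<le> even_singular_sum y"
      unfolding even_singular_sum_def sum_distrib_left using P
      by (intro sum_mono singular_series_ge_restricted \<open>finite P\<close>) auto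
    \<comment> \<open>The density 1/2 of the even numbers cancels the leading 2 of the singular
      series.\<close>
    also have "2 * twin_prime_const * (\<Sum>A\<in>Pow P. g A * (real y / (2 * real (\<Prod>A)) - 1)) =
        twin_prime_const * (\<Prod>p\<in>P. 1 / (1 - 1 / (real p - 1)\<^sup>2)) * real y - C"
    proof -
      have "(\<Sum>A\<in>Pow P. g A * (real y / (2 * real (\<Prod>A)) - 1)) =
            real y / 2 * (\<Sum>A\<in>Pow P. g A / real (\<Prod>A)) - (\<Sum>A\<in>Pow P. g A)"
        unfolding sum_distrib_left sum_subtractf[symmetric]
        by (intro sum.cong refl) (simp add: algebra_simps)
      thus ?thesis unfolding euler C_def by (simp only:) (simp add: field_simps)
    qed
    finally show ?thesis .
  qed
  with C show ?thesis by blast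
qed

text \<open>As \<open>P\<close> exhausts the odd primes, the product over \<open>P\<close> tends to
  the reciprocal of \<open>twin_prime_const\<close>. A finite cutoff \<open>M\<close> is fixed
  according to \<delta>, so \<open>C\<close> may depend on \<delta> but not on
  \<open>y\<close>.\<close>

lemma even_singular_sum_ge:
  fixes \<delta> :: real
  assumes "\<delta> > 0"
  shows "\<exists>C\<ge>0. \<forall>y. even_singular_sum y \<ge> (1 - \<delta>) * real y - C"
proof -
  define P where "P M = {p :: nat. prime p \<and> 2 < p \<and> p \<le> M}" for M
  have "(\<lambda>M. twin_prime_const / (\<Prod>p\<in>P M. 1 - 1 / (real p - 1)\<^sup>2)) \<longlonglongrightarrow>
        twin_prime_const / twin_prime_const"
    unfolding P_def
    by (intro tendsto_divide tendsto_const twin_prime_const_LIMSEQ less_imp_neq[OF twin_prime_const_pos, symmetric])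
  hence "\<forall>\<^sub>F M in sequentially. twin_prime_const / (\<Prod>p\<in>P M. 1 - 1 / (real p - 1)\<^sup>2) > 1 - \<delta>"
    using twin_prime_const_pos assms by (intro order_tendstoD) auto
  then obtain M where M: "twin_prime_const / (\<Prod>p\<in>P M. 1 - 1 / (real p - 1)\<^sup>2) > 1 - \<delta>"
    by (auto simp: eventually_sequentially)
  obtain C where C: "C \<ge> 0" "\<And>y. even_singular_sum y \<ge>
      twin_prime_const * (\<Prod>p\<in>P M. 1 / (1 - 1 / (real p - 1)\<^sup>2)) * real y - C"
  proof -
    have "finite (P M)" "\<And>p. p \<in> P M \<Longrightarrow> prime p \<and> p > 2" by (auto simp: P_def)
    from even_singular_sum_ge_restricted[OF this] that show ?thesis by blast
  qed
  have "(1 - \<delta>) * real y \<le> twin_prime_const * (\<Prod>p\<in>P M. 1 / (1 - 1 / (real p - 1)\<^sup>2)) * real y" for y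
    using M by (intro mult_right_mono) (simp_all add: prod_dividef)
  with C show ?thesis by (meson diff_right_mono order_trans)
qed

section \<open>A lower bound for the number of primes\<close>

text \<open>Eventually \<open>1 / (ln (ln x))^2\<close> is at most 1, so the error function drops
  below \<delta>. One threshold \<open>X\<close> serves all \<open>d\<close>, which permits
  summation over differences growing with \<open>x\<close>.\<close>

lemma uniform_prime_pairs_hypothesis_bound:
  fixes \<delta> :: real
  assumes "uniform_prime_pairs_hypothesis" "\<delta> > 0"
  shows "\<exists>X. \<forall>x\<ge>X. \<forall>d. even d \<and> 2 \<le> d \<and> real d \<le> x \<longrightarrow>
           \<bar>real (prime_pairs_count d x) - singular_series d * (x / (ln x)\<^sup>2)\<bar>
             \<le> \<delta> * (singular_series d * (x / (ln x)\<^sup>2))"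
proof -
  obtain \<eta> where \<eta>: "\<eta> \<in> o[at_top](\<lambda>x::real. 1 / (ln (ln x))\<^sup>2)"
    and asymp: "\<forall>\<^sub>F x in at_top. \<forall>d::nat. even d \<and> 2 \<le> d \<and> real d \<le> x \<longrightarrow>
          (\<exists>\<theta>::real. \<bar>\<theta>\<bar> \<le> \<eta> x \<and>
             real (prime_pairs_count d x) = singular_series d * (x / (ln x)\<^sup>2) * (1 + \<theta>))"
    using assms(1) unfolding uniform_prime_pairs_hypothesis_def by auto
  have small: "\<forall>\<^sub>F x in at_top. \<bar>\<eta> x\<bar> \<le> \<delta> * \<bar>1 / (ln (ln x))\<^sup>2\<bar>"
    using landau_o.smallD[OF \<eta> assms(2)] by simp
  have bounded: "\<forall>\<^sub>F x::real in at_top. \<bar>1 / (ln (ln x))\<^sup>2\<bar> \<le> 1"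
    by real_asymp
  have "\<forall>\<^sub>F x in at_top. \<forall>d. even d \<and> 2 \<le> d \<and> real d \<le> x \<longrightarrow>
      \<bar>real (prime_pairs_count d x) - singular_series d * (x / (ln x)\<^sup>2)\<bar>
        \<le> \<delta> * (singular_series d * (x / (ln x)\<^sup>2))"
    using asymp small bounded eventually_ge_at_top[of 0]
  proof eventually_elim
    case (elim x)
    show ?case
    proof (intro allI impI)
      fix d assume d: "even d \<and> 2 \<le> d \<and> real d \<le> x"
      then obtain \<theta> where \<theta>: "\<bar>\<theta>\<bar> \<le> \<eta> x"
        "real (prime_pairs_count d x) = singular_series d * (x / (ln x)\<^sup>2) * (1 + \<theta>)"
        using elim(1) by blast
      have "\<delta> * \<bar>1 / (ln (ln x))\<^sup>2\<bar> \<le> \<delta> * 1"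
        using elim(3) assms(2) by (intro mult_left_mono) auto
      hence \<theta>_le: "\<bar>\<theta>\<bar> \<le> \<delta>" using \<theta>(1) elim(2) by linarith
      define M where "M = singular_series d * (x / (ln x)\<^sup>2)"
      have "M \<ge> 0" unfolding M_def using singular_series_nonneg elim(4) by simp
      hence "\<bar>M * (1 + \<theta>) - M\<bar> = \<bar>\<theta>\<bar> * M"
        by (simp add: algebra_simps abs_mult)
      also have "\<dots> \<le> \<delta> * M" using \<theta>_le \<open>M \<ge> 0\<close> by (rule mult_right_mono)
      finally show "\<bar>real (prime_pairs_count d x) - singular_series d * (x / (ln x)\<^sup>2)\<bar>
        \<le> \<delta> * (singular_series d * (x / (ln x)\<^sup>2))"
        unfolding \<theta>(2) M_def .
    qed
  qed
  thus ?thesis by (simp add: eventually_at_top_linorder)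
qed

text \<open>Summation by parts: the weight \<open>n - d\<close> counts the \<open>j\<close> with
  \<open>d \<le> j < n\<close>.\<close>

lemma sum_weighted_eq_sum_partial_sums:
  fixes a :: "nat \<Rightarrow> real"
  shows "(\<Sum>d=1..n. a d * (real n - real d)) = (\<Sum>j<n. \<Sum>d=1..j. a d)"
proof (induction n)
  case (Suc n)
  have "(\<Sum>d=1..Suc n. a d * (real (Suc n) - real d)) = (\<Sum>d=1..n. a d * (real n - real d) + a d)"
    by (simp add: algebra_simps)
  with Suc show ?case by (simp add: sum.distrib)
qed auto

lemma sum_even_singular_weighted:
  "(\<Sum>d | d \<in> {1..n} \<and> even d. singular_series d * (real n - real d)) = (\<Sum>j<n. even_singular_sum j)"
proof -
  define a where "a d = (if even d then singular_series d else 0)" for d :: nat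
  have "(\<Sum>d | d \<in> {1..n} \<and> even d. singular_series d * (real n - real d)) =
        (\<Sum>d=1..n. a d * (real n - real d))"
    by (rule sum.mono_neutral_cong_left) (auto simp: a_def)
  also have "\<dots> = (\<Sum>j<n. \<Sum>d=1..j. a d)"
    by (rule sum_weighted_eq_sum_partial_sums)
  also have "\<dots> = (\<Sum>j<n. even_singular_sum j)"
    unfolding even_singular_sum_def
    by (intro sum.cong refl sum.mono_neutral_cong_right) (auto simp: a_def)
  finally show ?thesis .
qed

text \<open>Each pair occurs in both orders in \<open>Q \<times> Q\<close>, and the two copies
  differ because \<open>d\<close> is nonzero. The factor 2 is what makes the resulting count of
  primes asymptotically sharp.\<close>

lemma two_times_sum_pairs_le_card_squared:
  fixes Q E :: "nat set"
  assumes "finite Q" "finite E" "0 \<notin> E"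
  shows "2 * (\<Sum>d\<in>E. card {p\<in>Q. p + d \<in> Q}) \<le> (card Q)\<^sup>2"
proof -
  define S where "S = Sigma E (\<lambda>d. {p\<in>Q. p + d \<in> Q})"
  define f g :: "nat \<times> nat \<Rightarrow> nat \<times> nat"
    where "f = (\<lambda>(d, p). (p, p + d))" and "g = (\<lambda>(d, p). (p + d, p))"
  have finS: "finite S" unfolding S_def using assms by auto
  have cardS: "card S = (\<Sum>d\<in>E. card {p\<in>Q. p + d \<in> Q})"
    unfolding S_def using assms by (intro card_SigmaI) auto
  have "f ` S \<inter> g ` S = {}" using \<open>0 \<notin> E\<close> by (fastforce simp: f_def g_def S_def)
  hence "card (f ` S \<union> g ` S) = card (f ` S) + card (g ` S)"
    using finS by (intro card_Un_disjoint) auto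
  moreover have "inj_on f S" "inj_on g S" by (auto simp: inj_on_def f_def g_def)
  ultimately have "card (f ` S \<union> g ` S) = 2 * card S" by (simp add: card_image)
  moreover have "card (f ` S \<union> g ` S) \<le> card (Q \<times> Q)"
    using assms by (intro card_mono) (auto simp: f_def g_def S_def)
  ultimately show ?thesis
    using cardS by (simp add: card_cartesian_product power2_eq_square)
qed

section \<open>Primes in dyadic intervals\<close>

definition primes_in :: "nat \<Rightarrow> nat \<Rightarrow> nat set" where
  "primes_in a b = {p. prime p \<and> a < p \<and> p \<le> b}"

lemma finite_primes_in [simp, intro]: "finite (primes_in a b)"
  by (rule finite_subset[of _ "{..b}"]) (auto simp: primes_in_def)

text \<open>If \<open>x < p \<le> 2 * x - d\<close>, then \<open>p\<close> and \<open>p + d\<close>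
  both lie in the interval from \<open>x\<close> to \<open>2 * x\<close>.\<close>

lemma prime_pairs_count_diff_le:
  assumes "d \<le> x"
  shows "real (prime_pairs_count d (real (2 * x - d))) - real (prime_pairs_count d (real x))
           \<le> real (card {p\<in>primes_in x (2 * x). p + d \<in> primes_in x (2 * x)})"
proof -
  have fin: "finite {p. prime p \<and> real p \<le> real x \<and> prime (p + d)}"
    by (rule finite_subset[of _ "{..x}"]) auto
  have "{p. prime p \<and> real p \<le> real (2 * x - d) \<and> prime (p + d)} \<subseteq>
        {p. prime p \<and> real p \<le> real x \<and> prime (p + d)} \<union>
        {p\<in>primes_in x (2 * x). p + d \<in> primes_in x (2 * x)}"
    using assms by (auto simp: primes_in_def)
  hence "prime_pairs_count d (real (2 * x - d)) \<le>
        card ({p. prime p \<and> real p \<le> real x \<and> prime (p + d)} \<union>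
        {p\<in>primes_in x (2 * x). p + d \<in> primes_in x (2 * x)})"
    unfolding prime_pairs_count_def using fin by (intro card_mono) auto
  also have "\<dots> \<le> prime_pairs_count d (real x) +
      card {p\<in>primes_in x (2 * x). p + d \<in> primes_in x (2 * x)}"
    unfolding prime_pairs_count_def by (rule card_Un_le)
  finally show ?thesis by linarith
qed

lemma card_primes_in_dyadic_squared_ge:
  fixes \<delta> :: real
  assumes hyp: "uniform_prime_pairs_hypothesis" and \<delta>: "0 < \<delta>" "\<delta> \<le> 1 / 10"
  shows "\<forall>\<^sub>F x in sequentially.
           (1 - 14 * \<delta>) * (real x / ln (real x))\<^sup>2 \<le> (real (card (primes_in x (2 * x))))\<^sup>2"
proof -
  obtain X where X: "\<And>x d. x \<ge> X \<Longrightarrow> even d \<Longrightarrow> 2 \<le> d \<Longrightarrow> real d \<le> x \<Longrightarrow>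
      \<bar>real (prime_pairs_count d x) - singular_series d * (x / (ln x)\<^sup>2)\<bar>
        \<le> \<delta> * (singular_series d * (x / (ln x)\<^sup>2))"
    using uniform_prime_pairs_hypothesis_bound[OF hyp \<delta>(1)] by blast
  obtain C where C: "C \<ge> 0" "\<And>y. even_singular_sum y \<ge> (1 - \<delta>) * real y - C"
    using even_singular_sum_ge[OF \<delta>(1)] by blast
  have "(\<lambda>x. (ln (real x))\<^sup>2 / (ln (2 * real x))\<^sup>2) \<longlonglongrightarrow> 1" by real_asymp
  hence ln_ratio: "\<forall>\<^sub>F x in sequentially. (ln (real x))\<^sup>2 / (ln (2 * real x))\<^sup>2 > 1 - \<delta>"
    using \<delta> by (intro order_tendstoD) auto
  have "\<forall>\<^sub>F x in sequentially. real x \<ge> X"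
    using filterlim_real_sequentially by (auto simp: filterlim_at_top)
  \<comment> \<open>From here on the linear error \<open>(1 + 2 * C) * Y\<close> costs at most
    \<open>\<delta> * x^2\<close>.\<close>
  moreover have "\<forall>\<^sub>F x in sequentially. real x \<ge> (1 + 2 * C) / \<delta>"
    using filterlim_real_sequentially by (auto simp: filterlim_at_top)
  ultimately show ?thesis
    using ln_ratio eventually_ge_at_top[of 3]
  proof eventually_elim
    case (elim x)
    define L where "L = ln (real x)"
    \<comment> \<open>The bound obtained for difference \<open>d\<close> is
      \<open>(1 - \<delta>)^2 * (2 * x - d) - (1 + \<delta>) * x\<close>, which is at least
      \<open>(1 - 5 * \<delta>) * x - d\<close>. Differences beyond \<open>Y\<close> are
      discarded.\<close>
    define Y where "Y = nat \<lfloor>(1 - 5 * \<delta>) * real x\<rfloor>"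
    define Q where "Q = primes_in x (2 * x)"
    let ?E = "{d. d \<in> {1..Y} \<and> even d}"
    have "ln 1 < ln (real x)" using elim(4) by (subst ln_less_cancel_iff) auto
    hence L: "L > 0" unfolding L_def by simp
    have coeff: "(1 - 5 * \<delta>) * real x \<ge> 0" using \<delta> by (intro mult_nonneg_nonneg) auto
    have Y_le: "real Y \<le> (1 - 5 * \<delta>) * real x"
      unfolding Y_def using coeff by linarith
    have Y_ge: "real Y \<ge> (1 - 5 * \<delta>) * real x - 1"
      unfolding Y_def using coeff by linarith
    have "(1 - 5 * \<delta>) * real x \<le> 1 * real x" using \<delta> by (intro mult_right_mono) auto
    hence Yx: "real Y \<le> real x" using Y_le by linarith
    have x_big: "1 + 2 * C \<le> \<delta> * real x"
      using elim(2) \<delta> by (simp add: field_simps)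

    have pair: "singular_series d / L\<^sup>2 * (real Y - real d) \<le> real (card {p\<in>Q. p + d \<in> Q})"
      if d: "d \<in> ?E" for d
    proof -
      have d2: "even d" "2 \<le> d" "d \<le> x" using d Yx by (auto elim!: evenE)
      let ?z = "real (2 * x - d)"
      have z: "?z = 2 * real x - real d" using d2 by simp
      have zx: "real x \<le> ?z" "?z \<le> 2 * real x" using d2 by simp_all
      have lnz: "0 < ln ?z" "ln ?z \<le> ln (2 * real x)"
        using zx elim(4) by (auto intro!: ln_gt_zero)
      have "(1 - \<delta>) * (ln ?z)\<^sup>2 \<le> (1 - \<delta>) * (ln (2 * real x))\<^sup>2"
        using lnz \<delta> by (intro mult_left_mono power_mono) auto
      also have "\<dots> \<le> L\<^sup>2"
        using elim(3) lnz by (simp add: L_def field_simps)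
      finally have inv: "(1 - \<delta>) / L\<^sup>2 \<le> 1 / (ln ?z)\<^sup>2"
        using L lnz by (simp add: field_simps)
      \<comment> \<open>One factor \<open>1 - \<delta>\<close> pays for the hypothesis at
        \<open>?z\<close>, the other for replacing \<open>ln ?z\<close> by
        \<open>ln x\<close>.\<close>
      have "singular_series d / L\<^sup>2 * (real Y - real d) \<le>
            singular_series d / L\<^sup>2 * ((1 - \<delta>) * ((1 - \<delta>) * ?z) - (1 + \<delta>) * real x)"
      proof (rule mult_left_mono)
        have "(1 - 2 * \<delta>) * ?z \<le> (1 - \<delta>) * (1 - \<delta>) * ?z"
          using zx by (intro mult_right_mono) (auto simp: algebra_simps)
        moreover have "\<delta> * ?z \<le> \<delta> * (2 * real x)"
          using zx \<delta> by (intro mult_left_mono) auto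
        moreover have "(1 - 2 * \<delta>) * ?z = ?z - 2 * (\<delta> * ?z)" by (simp add: algebra_simps)
        moreover have "(1 + \<delta>) * real x = real x + \<delta> * real x"
          "(1 - 5 * \<delta>) * real x = real x - 5 * (\<delta> * real x)" by (simp_all add: algebra_simps)
        ultimately show "real Y - real d \<le> (1 - \<delta>) * ((1 - \<delta>) * ?z) - (1 + \<delta>) * real x"
          using Y_le z by (simp add: mult.assoc)
      qed (use singular_series_nonneg in auto)
      also have "\<dots> = singular_series d * ((1 - \<delta>) * (?z * ((1 - \<delta>) / L\<^sup>2)) - (1 + \<delta>) * (real x / L\<^sup>2))"
        using L by (simp add: field_simps)
      also have "\<dots> \<le> singular_series d * ((1 - \<delta>) * (?z * (1 / (ln ?z)\<^sup>2)) - (1 + \<delta>) * (real x / L\<^sup>2))"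
        using inv \<delta> singular_series_nonneg by (intro mult_left_mono diff_right_mono) auto
      also have "\<dots> = (1 - \<delta>) * (singular_series d * (?z / (ln ?z)\<^sup>2)) -
          (1 + \<delta>) * (singular_series d * (real x / (ln (real x))\<^sup>2))"
        unfolding L_def by (simp add: algebra_simps)
      also have "\<dots> \<le> real (prime_pairs_count d ?z) - real (prime_pairs_count d (real x))"
      proof -
        have "(1 - \<delta>) * M \<le> c \<and> c \<le> (1 + \<delta>) * M" if "\<bar>c - M\<bar> \<le> \<delta> * M" for c M :: real
          using that by (auto simp: abs_le_iff algebra_simps)
        from this[OF X[of ?z d]] this[OF X[of "real x" d]] d2 zx elim(1) show ?thesis
          by linarith
      qed
      also have "\<dots> \<le> real (card {p\<in>Q. p + d \<in> Q})"
        unfolding Q_def by (rule prime_pairs_count_diff_le) fact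
      finally show ?thesis .
    qed

    \<comment> \<open>Rounding gives \<open>Y \<ge> (1 - 6 * \<delta>) * x\<close>; then
      \<open>(1 - \<delta>) * (1 - 6 * \<delta>)^2\<close> is at least
      \<open>1 - 13 * \<delta>\<close>, and the linear term costs one more \<delta>.\<close>
    have "(1 - 14 * \<delta>) * (real x)\<^sup>2 \<le> (1 - \<delta>) * (real Y)\<^sup>2 - (1 + 2 * C) * real Y"
    proof -
      have "(1 - 6 * \<delta>) * real x \<le> real Y"
        using Y_ge x_big C by (simp add: algebra_simps)
      hence "((1 - 6 * \<delta>) * real x)\<^sup>2 \<le> (real Y)\<^sup>2"
        using \<delta> by (intro power_mono mult_nonneg_nonneg) auto
      hence "(1 - \<delta>) * ((1 - 6 * \<delta>) * real x)\<^sup>2 \<le> (1 - \<delta>) * (real Y)\<^sup>2"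
        using \<delta> by (intro mult_left_mono) auto
      moreover have "(1 - 13 * \<delta>) * (real x)\<^sup>2 \<le> (1 - \<delta>) * (1 - 6 * \<delta>)\<^sup>2 * (real x)\<^sup>2"
      proof (rule mult_right_mono)
        have "(1 - \<delta>) * (1 - 6 * \<delta>)\<^sup>2 - (1 - 13 * \<delta>) = \<delta>\<^sup>2 * (48 - 36 * \<delta>)"
          by (simp add: power2_eq_square algebra_simps)
        moreover have "\<delta>\<^sup>2 * (48 - 36 * \<delta>) \<ge> 0" using \<delta> by (intro mult_nonneg_nonneg) auto
        ultimately show "1 - 13 * \<delta> \<le> (1 - \<delta>) * (1 - 6 * \<delta>)\<^sup>2" by linarith
      qed auto
      moreover have "(1 + 2 * C) * real Y \<le> \<delta> * real x * real x"
        using x_big Yx C \<delta> by (intro mult_mono) auto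
      ultimately show ?thesis
        by (simp add: power_mult_distrib algebra_simps power2_eq_square)
    qed
    also have "\<dots> \<le> 2 * (\<Sum>j<Y. (1 - \<delta>) * real j - C)"
    proof -
      have "2 * (\<Sum>j<n. (1 - \<delta>) * real j - C) = (1 - \<delta>) * real n * (real n - 1) - 2 * C * real n" for n
        by (induction n) (auto simp: algebra_simps)
      thus ?thesis using \<delta> by (simp add: power2_eq_square algebra_simps)
    qed
    also have "\<dots> \<le> 2 * (\<Sum>j<Y. even_singular_sum j)"
      using C by (intro mult_left_mono sum_mono) auto
    also have "\<dots> = L\<^sup>2 * (2 * (\<Sum>d\<in>?E. singular_series d / L\<^sup>2 * (real Y - real d)))"
      unfolding sum_even_singular_weighted[symmetric] using L
      by (simp add: sum_distrib_left)
    also have "\<dots> \<le> L\<^sup>2 * (2 * (\<Sum>d\<in>?E. real (card {p\<in>Q. p + d \<in> Q})))"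
      using pair by (intro mult_left_mono sum_mono) auto
    also have "2 * (\<Sum>d\<in>?E. real (card {p\<in>Q. p + d \<in> Q})) =
        real (2 * (\<Sum>d\<in>?E. card {p\<in>Q. p + d \<in> Q}))" by simp
    also have "L\<^sup>2 * \<dots> \<le> L\<^sup>2 * real ((card Q)\<^sup>2)"
      by (intro mult_left_mono of_nat_mono two_times_sum_pairs_le_card_squared)
         (auto simp: Q_def)
    finally show ?case
      unfolding Q_def[symmetric] L_def[symmetric] using L
      by (simp add: field_simps power_divide)
  qed
qed

text \<open>Square root of the preceding bound with \<open>\<delta> = \<epsilon> / 14\<close>, using
  \<open>(1 - \<epsilon>)^2 \<le> 1 - \<epsilon>\<close> for \<open>\<epsilon> < 1\<close>.\<close>

lemma card_primes_in_dyadic_ge: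
  fixes \<epsilon> :: real
  assumes hyp: "uniform_prime_pairs_hypothesis" and "\<epsilon> > 0"
  shows "\<forall>\<^sub>F x in sequentially.
           (1 - \<epsilon>) * (real x / ln (real x)) \<le> real (card (primes_in x (2 * x)))"
proof (cases "\<epsilon> < 1")
  case True
  have "0 < \<epsilon> / 14" "\<epsilon> / 14 \<le> 1 / 10" using True \<open>\<epsilon> > 0\<close> by auto
  from card_primes_in_dyadic_squared_ge[OF hyp this] show ?thesis
  proof eventually_elim
    case (elim x)
    have "((1 - \<epsilon>) * (real x / ln (real x)))\<^sup>2 = (1 - \<epsilon>) * ((1 - \<epsilon>) * (real x / ln (real x))\<^sup>2)"
      by (simp add: power2_eq_square)
    also have "\<dots> \<le> 1 * ((1 - \<epsilon>) * (real x / ln (real x))\<^sup>2)"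
      using True \<open>\<epsilon> > 0\<close> by (intro mult_right_mono) auto
    also have "\<dots> \<le> (real (card (primes_in x (2 * x))))\<^sup>2" using elim by simp
    finally show ?case by (rule power2_le_imp_le) simp
  qed
next
  case False
  show ?thesis
    using eventually_ge_at_top[of 1]
  proof eventually_elim
    case (elim x)
    have "(1 - \<epsilon>) * (real x / ln (real x)) \<le> 0"
      using False elim by (intro mult_nonpos_nonneg) auto
    thus ?case by (smt (verit) of_nat_0_le_iff)
  qed
qed

text \<open>One dyadic step: with \<open>m = N div 2\<close>, the primes up to \<open>m\<close>
  contribute \<open>c\<close> and those between \<open>m\<close> and \<open>2 * m\<close> contribute
  1, both in units of \<open>m / ln m\<close>, which is about half of
  \<open>N / ln N\<close>.\<close>

lemma card_primes_in_halving:
  assumes hyp: "uniform_prime_pairs_hypothesis" and c: "0 \<le> c" "c \<le> 1"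
    and lower: "\<And>\<epsilon>::real. \<epsilon> > 0 \<Longrightarrow> \<forall>\<^sub>F N in sequentially.
                  (c - \<epsilon>) * (real N / ln (real N)) \<le> real (card (primes_in 0 N))"
    and "\<epsilon> > 0"
  shows "\<forall>\<^sub>F N in sequentially.
           ((1 + c) / 2 - \<epsilon>) * (real N / ln (real N)) \<le> real (card (primes_in 0 N))"
proof -
  \<comment> \<open>The two lower bounds together lose \<delta> in the averaged constant; the other
    \<delta> absorbs the rounding in \<open>N div 2\<close>.\<close>
  define \<delta> where "\<delta> = \<epsilon> / 2"
  have \<delta>: "\<delta> > 0" using \<open>\<epsilon> > 0\<close> by (simp add: \<delta>_def)
  have half: "filterlim (\<lambda>N::nat. N div 2) sequentially sequentially"
    by (rule filterlim_at_top_div_const_nat) simp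
  have "\<forall>\<^sub>F N in sequentially. real N \<ge> 1 / \<delta>"
    using filterlim_real_sequentially by (auto simp: filterlim_at_top)
  thus ?thesis
    using eventually_compose_filterlim[OF card_primes_in_dyadic_ge[OF hyp \<delta>] half]
      eventually_compose_filterlim[OF lower[OF \<delta>] half] eventually_ge_at_top[of 6]
  proof eventually_elim
    case (elim N)
    define m where "m = N div 2"
    have m: "m \<ge> 3" "real m \<ge> (real N - 1) / 2" "m \<le> N" using elim(4) by (auto simp: m_def)
    have ln: "0 < ln (real m)" "ln (real m) \<le> ln (real N)" using m by auto
    have split: "real (card (primes_in m (2 * m))) + real (card (primes_in 0 m)) \<le> real (card (primes_in 0 N))"
    proof -
      have "card (primes_in m (2 * m)) + card (primes_in 0 m) = card (primes_in m (2 * m) \<union> primes_in 0 m)"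
        by (intro card_Un_disjoint[symmetric]) (auto simp: primes_in_def)
      also have "\<dots> \<le> card (primes_in 0 N)"
        by (intro card_mono) (auto simp: primes_in_def m_def)
      finally show ?thesis by linarith
    qed
    show ?case
    proof (cases "(1 + c) / 2 - \<delta> \<ge> 0")
      case True
      have "((1 + c) / 2 - \<epsilon>) * real N \<le> ((1 + c) / 2 - \<delta>) * (real N - 1)"
      proof -
        have "\<delta> * real N \<ge> 1" using elim(1) \<delta> by (simp add: field_simps)
        moreover have "((1 + c) / 2 - \<epsilon>) * real N = ((1 + c) / 2 - \<delta>) * real N - \<delta> * real N"
          by (simp add: \<delta>_def algebra_simps)
        moreover have "((1 + c) / 2 - \<delta>) * (real N - 1) = ((1 + c) / 2 - \<delta>) * real N - ((1 + c) / 2 - \<delta>)"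
          by (simp only: right_diff_distrib mult_1_right)
        moreover have "(1 + c) / 2 - \<delta> \<le> 1" using c \<delta> by (simp add: field_simps)
        ultimately show ?thesis by linarith
      qed
      also have "\<dots> \<le> ((1 + c) / 2 - \<delta>) * (2 * real m)"
        using m True by (intro mult_left_mono) auto
      finally have "((1 + c) / 2 - \<epsilon>) * real N / ln (real N) \<le> ((1 + c) / 2 - \<delta>) * (2 * real m) / ln (real N)"
        using ln by (intro divide_right_mono) auto
      also have "\<dots> \<le> ((1 + c) / 2 - \<delta>) * (2 * real m) / ln (real m)"
        using ln True by (intro divide_left_mono mult_nonneg_nonneg mult_pos_pos) auto
      also have "\<dots> = (1 - \<delta>) * (real m / ln (real m)) + (c - \<delta>) * (real m / ln (real m))"
        using ln by (simp add: field_simps)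
      also have "\<dots> \<le> real (card (primes_in 0 N))"
        using elim(2,3) split unfolding m_def by linarith
      finally show ?thesis by simp
    next
      case False
      hence "((1 + c) / 2 - \<epsilon>) * (real N / ln (real N)) \<le> 0"
        using \<delta> ln by (intro mult_nonpos_nonneg) (auto simp: \<delta>_def)
      thus ?thesis by (smt (verit) of_nat_0_le_iff)
    qed
  qed
qed

text \<open>Starting from the trivial constant 0, \<open>j\<close> halving steps reach
  \<open>1 - (1 / 2)^j\<close>, so finitely many dyadic intervals suffice for each
  \<open>\<epsilon>\<close>.\<close>

lemma card_primes_in_ge:
  fixes \<epsilon> :: real
  assumes hyp: "uniform_prime_pairs_hypothesis" and "\<epsilon> > 0"
  shows "\<forall>\<^sub>F N in sequentially.
           (1 - \<epsilon>) * (real N / ln (real N)) \<le> real (card (primes_in 0 N))"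
proof -
  have iter: "\<forall>\<^sub>F N in sequentially.
      (1 - (1 / 2) ^ j - \<delta>) * (real N / ln (real N)) \<le> real (card (primes_in 0 N))"
    if "\<delta> > 0" for j :: nat and \<delta> :: real
    using that
  \<comment> \<open>The halving step needs the previous bound for every positive error, hence the
    generalization over \<delta>.\<close>
  proof (induction j arbitrary: \<delta>)
    case 0
    show ?case
      using eventually_ge_at_top[of 1]
    proof eventually_elim
      case (elim N)
      have "(1 - (1 / 2) ^ 0 - \<delta>) * (real N / ln (real N)) \<le> 0"
        using 0 elim by (intro mult_nonpos_nonneg) auto
      thus ?case by (smt (verit) of_nat_0_le_iff)
    qed
  next
    case (Suc j)
    have "(1 / 2 :: real) ^ j \<le> 1" by (intro power_le_one) auto
    hence "0 \<le> 1 - (1 / 2 :: real) ^ j" "1 - (1 / 2 :: real) ^ j \<le> 1" by auto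
    from card_primes_in_halving[OF hyp this Suc.IH Suc.prems] show ?case
      by (simp add: field_simps)
  qed
  obtain j where j: "(1 / 2 :: real) ^ j < \<epsilon> / 2"
    using real_arch_pow_inv[of "\<epsilon> / 2" "1 / 2"] \<open>\<epsilon> > 0\<close> by auto
  have "\<epsilon> / 2 > 0" using \<open>\<epsilon> > 0\<close> by simp
  from iter[OF this, of j] eventually_ge_at_top[of 1] show ?thesis
  proof eventually_elim
    case (elim N)
    have "(1 - \<epsilon>) * (real N / ln (real N)) \<le> (1 - (1 / 2) ^ j - \<epsilon> / 2) * (real N / ln (real N))"
      using j elim by (intro mult_right_mono) auto
    with elim(1) show ?case by linarith
  qed
qed

section \<open>First and second moments\<close>

text \<open>The numbers represented with exponent \<open>k\<close>, where \<open>m\<close> is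
  \<open>n - k\<close>; the condition \<open>k < n\<close> makes \<open>m\<close> positive and the
  subtraction exact.\<close>

definition hits :: "nat \<Rightarrow> nat \<Rightarrow> nat set" where
  "hits N k = {n \<in> {1..N}. k < n \<and> prime (2 ^ k + (n - k))}"

lemma finite_hits [simp, intro]: "finite (hits N k)"
  by (simp add: hits_def)

lemma finite_R: "finite (R N)"
  by (rule finite_subset[of _ "{..N}"]) (auto simp: R_def)

lemma hits_subset_R:
  assumes "k \<ge> 1"
  shows "hits N k \<subseteq> R N"
proof
  fix n assume "n \<in> hits N k"
  hence "n \<le> N" "n - k \<ge> 1" "n = (n - k) + k" "prime (2 ^ k + (n - k))"
    by (auto simp: hits_def)
  with assms show "n \<in> R N" unfolding R_def by blast
qed

text \<open>Cauchy--Schwarz for the multiplicity \<open>r n\<close>, the number of \<open>i\<close>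
  with \<open>n \<in> A i\<close>: its sum is the first moment, and expanding its square produces
  the intersections.\<close>

lemma sum_card_squared_le_card_mult_sum_inter:
  fixes A :: "'a \<Rightarrow> 'b set"
  assumes "finite I" "finite S" and sub: "\<And>i. i \<in> I \<Longrightarrow> A i \<subseteq> S"
  shows "(\<Sum>i\<in>I. real (card (A i)))\<^sup>2 \<le> real (card S) * (\<Sum>i\<in>I. \<Sum>j\<in>I. real (card (A i \<inter> A j)))"
proof -
  define r where "r n = (\<Sum>i\<in>I. of_bool (n \<in> A i) :: real)" for n
  have card_eq: "real (card B) = (\<Sum>n\<in>S. of_bool (n \<in> B))" if "B \<subseteq> S" for B
  proof -
    have "S \<inter> {n. n \<in> B} = B" using that by auto
    thus ?thesis using \<open>finite S\<close> by (simp add: of_bool_def sum.If_cases)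
  qed
  have first: "(\<Sum>i\<in>I. real (card (A i))) = (\<Sum>n\<in>S. r n)"
    unfolding r_def by (subst sum.swap) (use card_eq sub in simp)
  have "(\<Sum>i\<in>I. \<Sum>j\<in>I. real (card (A i \<inter> A j))) =
        (\<Sum>i\<in>I. \<Sum>j\<in>I. \<Sum>n\<in>S. of_bool (n \<in> A i) * of_bool (n \<in> A j))"
  proof (intro sum.cong refl)
    fix i j assume "i \<in> I" "j \<in> I"
    hence "A i \<inter> A j \<subseteq> S" using sub by blast
    from card_eq[OF this]
    show "real (card (A i \<inter> A j)) = (\<Sum>n\<in>S. of_bool (n \<in> A i) * of_bool (n \<in> A j))"
      by (simp add: of_bool_conj)
  qed
  also have "\<dots> = (\<Sum>i\<in>I. \<Sum>n\<in>S. \<Sum>j\<in>I. of_bool (n \<in> A i) * of_bool (n \<in> A j))"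
    by (intro sum.cong refl sum.swap)
  also have "\<dots> = (\<Sum>n\<in>S. \<Sum>i\<in>I. \<Sum>j\<in>I. of_bool (n \<in> A i) * of_bool (n \<in> A j))"
    by (rule sum.swap)
  also have "\<dots> = (\<Sum>n\<in>S. (r n)\<^sup>2)"
    unfolding r_def power2_eq_square by (simp only: sum_product)
  finally have second: "(\<Sum>i\<in>I. \<Sum>j\<in>I. real (card (A i \<inter> A j))) = (\<Sum>n\<in>S. (r n)\<^sup>2)" .
  show ?thesis
    unfolding first second using sum_squared_le_sum_of_squares[of r S] by (simp add: mult.commute)
qed

lemma sum_symmetric_eq_diagonal_plus:
  fixes c :: "nat \<Rightarrow> nat \<Rightarrow> real"
  assumes sym: "\<And>k l. c k l = c l k"
  shows "(\<Sum>k=1..n. \<Sum>l=1..n. c k l) =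
           (\<Sum>k=1..n. c k k) + 2 * (\<Sum>h=1..n-1. \<Sum>l=1..n-h. c (l + h) l)"
proof -
  have "(\<Sum>k=1..n. \<Sum>l=1..n. c k l) = (\<Sum>k=1..n. c k k) + 2 * (\<Sum>k=1..n. \<Sum>l\<in>{1..<k}. c k l)"
  proof (induction n)
    case (Suc n)
    have "(\<Sum>k=1..n. c k (Suc n)) = (\<Sum>l=1..n. c (Suc n) l)"
      by (intro sum.cong refl sym)
    with Suc show ?case
      by (simp add: sum.distrib atLeastLessThanSuc_atLeastAtMost)
  qed auto
  also have "(\<Sum>k=1..n. \<Sum>l\<in>{1..<k}. c k l) = (\<Sum>(k, l)\<in>Sigma {1..n} (\<lambda>k. {1..<k}). c k l)"
    by (rule sum.Sigma) auto
  also have "\<dots> = (\<Sum>(h, l)\<in>Sigma {1..n-1} (\<lambda>h. {1..n-h}). c (l + h) l)"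
    \<comment> \<open>The strict lower triangle is reparametrized by the gap
      \<open>h = k - l\<close>, giving the index ranges of \<open>Phi\<close>.\<close>
    by (rule sum.reindex_bij_witness[of _ "\<lambda>(h, l). (l + h, l)" "\<lambda>(k, l). (k - l, l)"]) auto
  also have "\<dots> = (\<Sum>h=1..n-1. \<Sum>l=1..n-h. c (l + h) l)"
    by (rule sum.Sigma[symmetric]) auto
  finally show ?thesis .
qed

section \<open>Pairs of representations and their differences\<close>

lemma d_diff_add: "d_diff l h + h + 2 ^ l = 2 ^ (l + h)"
proof -
  have "int (d_diff l h + h + 2 ^ l) = int (2 ^ (l + h))"
    by (simp add: int_d_diff power_add algebra_simps)
  thus ?thesis by (simp only: of_nat_eq_iff)
qed

lemma even_d_diff_iff: "l \<ge> 1 \<Longrightarrow> even (d_diff l h) \<longleftrightarrow> even h"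
proof -
  assume "l \<ge> 1"
  hence "even (d_diff l h + h + 2 ^ l)" unfolding d_diff_add by simp
  thus ?thesis using \<open>l \<ge> 1\<close> by simp
qed

text \<open>Ensures that even \<open>h \<ge> 2\<close> yields a difference of at least 2, as the
  prime pairs hypothesis requires. Here \<open>l \<ge> 1\<close> supplies
  \<open>2 * (2^h - 1) \<ge> 2 * h\<close>.\<close>

lemma d_diff_ge: 
  assumes "l \<ge> 1"
  shows "d_diff l h \<ge> h"
proof -
  have "h \<le> 2 ^ h - 1" using less_exp[of h] by linarith
  moreover have "2 * (2 ^ h - 1) \<le> (2::nat) ^ l * (2 ^ h - 1)"
    using assms self_le_power[of 2 l] by (intro mult_right_mono) auto
  ultimately show ?thesis unfolding d_diff_def by linarith
qed

lemma hits_inter_shift: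
  assumes "n \<in> hits N (l + h) \<inter> hits N l"
  shows "prime (2 ^ l + (n - l))" "prime (2 ^ l + (n - l) + d_diff l h)"
proof -
  have "2 ^ l + (n - l) + d_diff l h = 2 ^ (l + h) + (n - (l + h))"
    using d_diff_add[of l h] assms by (auto simp: hits_def)
  thus "prime (2 ^ l + (n - l))" "prime (2 ^ l + (n - l) + d_diff l h)"
    using assms by (auto simp: hits_def)
qed

text \<open>A common \<open>n\<close> is sent to the smaller prime of its pair. The cutoff
  \<open>N + 2^\<kappa>\<close> is the same for all \<open>l\<close> and \<open>h\<close>, so the
  hypothesis is applied at a single \<open>x\<close>.\<close>

lemma card_hits_inter_le:
  assumes "l \<le> \<kappa>"
  shows "card (hits N (l + h) \<inter> hits N l) \<le> prime_pairs_count (d_diff l h) (real N + 2 ^ \<kappa>)"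
  unfolding prime_pairs_count_def
proof (rule card_inj_on_le[where f = "\<lambda>n. 2 ^ l + (n - l)"])
  show "inj_on (\<lambda>n. 2 ^ l + (n - l)) (hits N (l + h) \<inter> hits N l)"
    by (auto simp: inj_on_def hits_def)
  have "p \<le> N + 2 ^ \<kappa>" if "real p \<le> real N + 2 ^ \<kappa>" for p
    using that by (metis of_nat_add of_nat_le_iff of_nat_numeral of_nat_power)
  hence "{p. prime p \<and> real p \<le> real N + 2 ^ \<kappa> \<and> prime (p + d_diff l h)} \<subseteq> {..N + 2 ^ \<kappa>}"
    by blast
  thus "finite {p. prime p \<and> real p \<le> real N + 2 ^ \<kappa> \<and> prime (p + d_diff l h)}"
    by (rule finite_subset) simp
  have pow: "(2::real) ^ l \<le> 2 ^ \<kappa>" using assms by (intro power_increasing) auto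
  have "real (2 ^ l + (n - l)) \<le> real N + 2 ^ \<kappa>" if "n \<in> hits N l" for n
  proof -
    have "n - l \<le> N" using that by (auto simp: hits_def)
    hence "real (n - l) \<le> real N" by (rule of_nat_mono)
    thus ?thesis using pow unfolding of_nat_add of_nat_power of_nat_numeral by linarith
  qed
  thus "(\<lambda>n. 2 ^ l + (n - l)) ` (hits N (l + h) \<inter> hits N l) \<subseteq>
      {p. prime p \<and> real p \<le> real N + 2 ^ \<kappa> \<and> prime (p + d_diff l h)}"
    using hits_inter_shift[of _ N l h] by blast
qed

text \<open>An odd \<open>h\<close> gives an odd difference, impossible for two primes above 2; the
  smaller one exceeds 2 because \<open>2^l \<ge> 2\<close> and \<open>n > l\<close>.\<close>

lemma hits_inter_empty:
  assumes "l \<ge> 1" "odd h"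
  shows "hits N (l + h) \<inter> hits N l = {}"
proof (rule ccontr)
  assume "hits N (l + h) \<inter> hits N l \<noteq> {}"
  then obtain n where n: "n \<in> hits N (l + h) \<inter> hits N l" by blast
  define p where "p = 2 ^ l + (n - l)"
  have p: "prime p" "prime (p + d_diff l h)" using hits_inter_shift[OF n] by (simp_all add: p_def)
  have "(2::nat) \<le> 2 ^ l" using assms self_le_power[of 2 l] by auto
  hence "p > 2" using n by (auto simp: p_def hits_def)
  hence "odd p" "odd (p + d_diff l h)"
    using p prime_odd_nat[of p] prime_odd_nat[of "p + d_diff l h"] by linarith+
  thus False using assms even_d_diff_iff[of l h] by simp
qed

text \<open>A prime \<open>p > 2^k\<close> yields \<open>n = p - 2^k + k\<close>, which stays below
  \<open>p\<close> since \<open>k < 2^k\<close>; at most \<open>2^k\<close> primes are lost.\<close>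

lemma card_hits_ge:
  "real (card (primes_in 0 N)) - 2 ^ k \<le> real (card (hits N k))"
proof -
  have k: "k < 2 ^ k" by (rule less_exp)
  have "card (primes_in (2 ^ k) N) \<le> card (hits N k)"
  proof (rule card_inj_on_le[where f = "\<lambda>p. p - 2 ^ k + k"])
    show "inj_on (\<lambda>p. p - 2 ^ k + k) (primes_in (2 ^ k) N)"
      by (auto simp: inj_on_def primes_in_def)
    show "(\<lambda>p. p - 2 ^ k + k) ` primes_in (2 ^ k) N \<subseteq> hits N k"
      using k unfolding primes_in_def hits_def by (auto; linarith)
  qed auto
  moreover have "card (primes_in 0 N) \<le> card (primes_in (2 ^ k) N \<union> {1..2 ^ k})"
    by (intro card_mono) (auto simp: primes_in_def)
  moreover have "card (primes_in (2 ^ k) N \<union> {1..2 ^ k}) \<le> card (primes_in (2 ^ k) N) + 2 ^ k"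
    using card_Un_le[of "primes_in (2 ^ k) N" "{1..2 ^ k}"] by simp
  ultimately have "card (primes_in 0 N) \<le> card (hits N k) + 2 ^ k" by linarith
  hence "real (card (primes_in 0 N)) \<le> real (card (hits N k) + 2 ^ k)" by (rule of_nat_mono)
  thus ?thesis by simp
qed

lemma sum_card_hits_ge:
  "real n * real (card (primes_in 0 N)) - 2 * 2 ^ n \<le> (\<Sum>k=1..n. real (card (hits N k)))"
proof -
  have "(\<Sum>k=1..n. 2 ^ k :: real) \<le> 2 * 2 ^ n" by (induction n) auto
  hence "real n * real (card (primes_in 0 N)) - 2 * 2 ^ n \<le>
        (\<Sum>k=1..n. real (card (primes_in 0 N)) - 2 ^ k)"
    by (simp add: sum_subtractf)
  also have "\<dots> \<le> (\<Sum>k=1..n. real (card (hits N k)))"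
    by (intro sum_mono card_hits_ge)
  finally show ?thesis .
qed

lemma card_R_second_moment:
  defines "S \<equiv> \<lambda>N n. \<Sum>k=1..n. real (card (hits N k))"
  shows "(S N n)\<^sup>2 \<le> real (card (R N)) * (S N n +
           2 * (\<Sum>h | 1 \<le> h \<and> h \<le> n - 1 \<and> even h. \<Sum>l=1..n-h.
                  real (prime_pairs_count (d_diff l h) (real N + 2 ^ n))))"
proof -
  let ?c = "\<lambda>k l. real (card (hits N k \<inter> hits N l))"
  have "(S N n)\<^sup>2 \<le> real (card (R N)) * (\<Sum>k=1..n. \<Sum>l=1..n. ?c k l)"
    unfolding S_def by (intro sum_card_squared_le_card_mult_sum_inter finite_R hits_subset_R) auto
  also have "(\<Sum>k=1..n. \<Sum>l=1..n. ?c k l) = S N n + 2 * (\<Sum>h=1..n-1. \<Sum>l=1..n-h. ?c (l + h) l)"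
    using sum_symmetric_eq_diagonal_plus[of ?c n] by (simp add: S_def Int_commute)
  \<comment> \<open>Odd \<open>h\<close> contribute nothing, which leaves the range of
    \<open>h\<close> in \<open>Phi\<close>.\<close>
  also have "(\<Sum>h=1..n-1. \<Sum>l=1..n-h. ?c (l + h) l) =
      (\<Sum>h | 1 \<le> h \<and> h \<le> n - 1 \<and> even h. \<Sum>l=1..n-h. ?c (l + h) l)"
    by (intro sum.mono_neutral_right ballI sum.neutral) (auto simp: hits_inter_empty)
  also have "real (card (R N)) * (S N n + 2 * \<dots>) \<le> real (card (R N)) * (S N n +
      2 * (\<Sum>h | 1 \<le> h \<and> h \<le> n - 1 \<and> even h. \<Sum>l=1..n-h.
        real (prime_pairs_count (d_diff l h) (real N + 2 ^ n))))"
    by (intro mult_left_mono add_left_mono sum_mono of_nat_mono card_hits_inter_le) auto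
  finally show ?thesis .
qed

section \<open>Asymptotics\<close>

lemma K_bounds:
  fixes \<delta> :: real
  assumes "\<delta> > 0"
  shows "\<forall>\<^sub>F N in sequentially.
           (1 - \<delta>) * (ln (real N) / ln 2) \<le> real (K N) \<and> real (K N) \<le> ln (real N) / ln 2 \<and>
           2 ^ K N \<le> real N / (ln (real N))\<^sup>2"
proof -
  \<comment> \<open>The \<open>- 1\<close> accounts for the floor in \<open>K\<close>.\<close>
  have "(\<lambda>N. (log 2 (real N) - 2 * log 2 (ln (real N)) - 1) / (ln (real N) / ln 2)) \<longlonglongrightarrow> 1"
    by real_asymp
  hence ratio: "\<forall>\<^sub>F N in sequentially.
      (log 2 (real N) - 2 * log 2 (ln (real N)) - 1) / (ln (real N) / ln 2) > 1 - \<delta>"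
    using assms by (intro order_tendstoD) auto
  have nonneg: "\<forall>\<^sub>F N in sequentially. log 2 (real N) - 2 * log 2 (ln (real N)) \<ge> 0"
    by real_asymp
  have lnln: "\<forall>\<^sub>F N in sequentially. log 2 (ln (real N)) \<ge> 0"
    by real_asymp
  show ?thesis
    using ratio nonneg lnln eventually_ge_at_top[of 3]
  proof eventually_elim
    case (elim N)
    define y where "y = log 2 (real N) - 2 * log 2 (ln (real N))"
    have lnN: "ln (real N) > 0" using elim(4) by simp
    have K: "y - 1 \<le> real (K N)" "real (K N) \<le> y"
      unfolding K_def y_def[symmetric] using elim(2) unfolding y_def[symmetric] by linarith+
    have "1 - \<delta> < (y - 1) / (ln (real N) / ln 2)" using elim(1) unfolding y_def .
    moreover have "ln (real N) / ln 2 > 0" using lnN by simp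
    ultimately have "(1 - \<delta>) * (ln (real N) / ln 2) \<le> y - 1"
      using pos_less_divide_eq less_imp_le by blast
    moreover have "y \<le> ln (real N) / ln 2"
      using elim(3) by (simp add: y_def log_def)
    moreover have "2 ^ K N \<le> real N / (ln (real N))\<^sup>2"
    proof -
      have "(2::real) ^ K N = 2 powr real (K N)" by (simp add: powr_realpow)
      also have "\<dots> \<le> 2 powr y" using K by simp
      also have "\<dots> = real N / (2 powr log 2 (ln (real N))) powr 2"
        unfolding y_def powr_diff powr_powr using elim(4) by (simp add: mult.commute)
      also have "\<dots> = real N / (ln (real N))\<^sup>2" using lnN by simp
      finally show ?thesis .
    qed
    ultimately show ?case using K by linarith
  qed
qed

section \<open>Upper bound for the pairs, lower bound for the first moment\<close>

lemma Phi_nonneg: "Phi N \<ge> 0"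
  unfolding Phi_def by (intro mult_nonneg_nonneg sum_nonneg singular_series_nonneg) auto

lemma sum_prime_pairs_count_le:
  fixes \<delta> :: real
  assumes hyp: "uniform_prime_pairs_hypothesis" and \<delta>: "0 < \<delta>" "\<delta> \<le> 1"
  shows "\<forall>\<^sub>F N in sequentially.
           (\<Sum>h | 1 \<le> h \<and> h \<le> K N - 1 \<and> even h. \<Sum>l=1..K N-h.
              real (prime_pairs_count (d_diff l h) (real N + 2 ^ K N)))
             \<le> (1 + 3 * \<delta>) * (Phi N / (ln 2)\<^sup>2) * real N"
proof -
  obtain X where X: "\<And>x d. x \<ge> X \<Longrightarrow> even d \<Longrightarrow> 2 \<le> d \<Longrightarrow> real d \<le> x \<Longrightarrow>
      \<bar>real (prime_pairs_count d x) - singular_series d * (x / (ln x)\<^sup>2)\<bar>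
        \<le> \<delta> * (singular_series d * (x / (ln x)\<^sup>2))"
    using uniform_prime_pairs_hypothesis_bound[OF hyp \<delta>(1)] by blast
  have "\<forall>\<^sub>F N in sequentially. real N \<ge> X"
    using filterlim_real_sequentially by (auto simp: filterlim_at_top)
  moreover have "(\<lambda>N. 1 / (ln (real N))\<^sup>2) \<longlonglongrightarrow> 0" by real_asymp
  hence "\<forall>\<^sub>F N in sequentially. 1 / (ln (real N))\<^sup>2 < \<delta>"
    using \<delta> by (intro order_tendstoD) auto
  ultimately show ?thesis
    using K_bounds[OF \<delta>(1)] eventually_ge_at_top[of 3]
  proof eventually_elim
    case (elim N)
    define x where "x = real N + 2 ^ K N"
    define T where "T = (\<Sum>h | 1 \<le> h \<and> h \<le> K N - 1 \<and> even h. \<Sum>l=1..K N-h. singular_series (d_diff l h))"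
    have T: "T \<ge> 0" unfolding T_def by (intro sum_nonneg singular_series_nonneg)
    have L: "ln (real N) > 0" using elim(4) by simp
    have xN: "real N \<le> x" by (simp add: x_def)
    have lnx: "0 < ln x" "ln (real N) \<le> ln x" using xN elim(4) by auto
    have "2 ^ K N \<le> real N * (1 / (ln (real N))\<^sup>2)" using elim(3) by simp
    also have "\<dots> \<le> real N * \<delta>" using elim(2) by (intro mult_left_mono) auto
    finally have x_le: "x \<le> (1 + \<delta>) * real N" by (simp add: x_def algebra_simps)

    have pair: "real (prime_pairs_count (d_diff l h) x) \<le> (1 + \<delta>) * (x / (ln x)\<^sup>2) * singular_series (d_diff l h)"
      if "1 \<le> h" "even h" "l \<in> {1..K N - h}" "h \<le> K N - 1" for l h
    proof -
      \<comment> \<open>The difference must lie in the range of the hypothesis: it is at least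
        \<open>h \<ge> 2\<close> and at most \<open>2^(l + h) \<le> 2^K N \<le> x\<close>.\<close>
      have "2 \<le> h" using that by (auto elim!: evenE)
      hence "2 \<le> d_diff l h" using d_diff_ge[of l h] that by auto
      moreover have "d_diff l h \<le> 2 ^ (l + h)" using d_diff_add[of l h] by linarith
      hence "real (d_diff l h) \<le> 2 ^ (l + h)"
        by (metis of_nat_le_iff of_nat_numeral of_nat_power)
      moreover have "(2::real) ^ (l + h) \<le> 2 ^ K N" using that by (intro power_increasing) auto
      moreover have "even (d_diff l h)" using that even_d_diff_iff by auto
      moreover have "(2::real) ^ K N \<le> x" by (simp add: x_def)
      ultimately have "real (prime_pairs_count (d_diff l h) x) - singular_series (d_diff l h) * (x / (ln x)\<^sup>2)
          \<le> \<delta> * (singular_series (d_diff l h) * (x / (ln x)\<^sup>2))"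
        using X[of x "d_diff l h"] xN elim(1) by linarith
      thus ?thesis by (simp add: algebra_simps add_divide_distrib)
    qed
    have "(\<Sum>h | 1 \<le> h \<and> h \<le> K N - 1 \<and> even h. \<Sum>l=1..K N-h. real (prime_pairs_count (d_diff l h) x))
        \<le> (1 + \<delta>) * (x / (ln x)\<^sup>2) * T"
      unfolding T_def sum_distrib_left by (intro sum_mono pair) auto
    also have "\<dots> \<le> (1 + \<delta>) * ((1 + \<delta>) * real N / (ln (real N))\<^sup>2) * T"
      using x_le xN lnx L T \<delta> by (intro mult_right_mono mult_left_mono frac_le power_mono) auto
    also have "\<dots> = (1 + \<delta>) * (1 + \<delta>) * (real N / (ln (real N))\<^sup>2 * T)"
      by simp
    also have "\<dots> \<le> (1 + 3 * \<delta>) * (real N * (Phi N / (ln 2)\<^sup>2))"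
    proof (rule mult_mono)
      show "(1 + \<delta>) * (1 + \<delta>) \<le> 1 + 3 * \<delta>"
        using \<delta> mult_left_le[of \<delta> \<delta>] by (simp add: algebra_simps)
      \<comment> \<open>For \<open>K N = 0\<close> the factor \<open>1 / 0\<close> is 0 by
        convention, and the sum is empty as well.\<close>
      have T_eq: "T = (real (K N))\<^sup>2 * Phi N"
      proof (cases "K N = 0")
        case True
        have "{h. 1 \<le> h \<and> h \<le> K N - 1 \<and> even h} = {}" using True by auto
        thus ?thesis using True unfolding T_def by simp
      next
        case False
        thus ?thesis unfolding T_def Phi_def by simp
      qed
      have "(real (K N))\<^sup>2 \<le> (ln (real N) / ln 2)\<^sup>2" using elim(3) by (intro power_mono) auto
      hence "T \<le> (ln (real N) / ln 2)\<^sup>2 * Phi N"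
        unfolding T_eq using Phi_nonneg by (intro mult_right_mono) auto
      hence "real N / (ln (real N))\<^sup>2 * T \<le> real N / (ln (real N))\<^sup>2 * ((ln (real N) / ln 2)\<^sup>2 * Phi N)"
        by (intro mult_left_mono) auto
      also have "\<dots> = real N * (Phi N / (ln 2)\<^sup>2)"
        using L by (simp add: power_divide)
      finally show "real N / (ln (real N))\<^sup>2 * T \<le> real N * (Phi N / (ln 2)\<^sup>2)" .
    qed (use T \<delta> in auto)
    finally show ?case unfolding x_def by (simp add: mult_ac)
  qed
qed

text \<open>The main term is \<open>K N\<close> times the number of primes up to \<open>N\<close>,
  about \<open>(ln N / ln 2) * (N / ln N)\<close>. Each factor loses \<delta>; the discarded small
  primes cost another \<open>2 * \<delta>\<close>, because \<open>2^K N\<close> is of smaller order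
  than \<open>N\<close>.\<close>

lemma sum_card_hits_K_ge:
  fixes \<delta> :: real
  assumes hyp: "uniform_prime_pairs_hypothesis" and \<delta>: "0 < \<delta>" "\<delta> \<le> 1"
  shows "\<forall>\<^sub>F N in sequentially.
           (1 - 4 * \<delta>) / ln 2 * real N \<le> (\<Sum>k=1..K N. real (card (hits N k)))"
proof -
  have "(\<lambda>N. 1 / (ln (real N))\<^sup>2) \<longlonglongrightarrow> 0" by real_asymp
  hence "\<forall>\<^sub>F N in sequentially. 1 / (ln (real N))\<^sup>2 < \<delta>"
    using \<delta> by (intro order_tendstoD) auto
  thus ?thesis
    using K_bounds[OF \<delta>(1)] card_primes_in_ge[OF hyp \<delta>(1)] eventually_ge_at_top[of 3]
  proof eventually_elim
    case (elim N)
    have L: "ln (real N) > 0" using elim(4) by simp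
    have "2 ^ K N \<le> real N * (1 / (ln (real N))\<^sup>2)" using elim(2) by simp
    also have "\<dots> \<le> real N * \<delta>" using elim(1) by (intro mult_left_mono) auto
    also have "\<dots> \<le> real N * (\<delta> / ln 2)"
      using \<delta> ln_2_less_1 by (intro mult_left_mono) (auto simp: field_simps)
    finally have pow: "2 ^ K N \<le> real N * (\<delta> / ln 2)" .
    have "(1 - 2 * \<delta>) * (real N / ln 2) \<le> (1 - \<delta>) * (1 - \<delta>) * (real N / ln 2)"
      by (intro mult_right_mono) (auto simp: algebra_simps)
    also have "\<dots> = ((1 - \<delta>) * (ln (real N) / ln 2)) * ((1 - \<delta>) * (real N / ln (real N)))"
      using L by simp
    also have "\<dots> \<le> real (K N) * real (card (primes_in 0 N))"
      using elim(2,3) \<delta> L by (intro mult_mono) auto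
    finally have "(1 - 2 * \<delta>) * (real N / ln 2) - 2 * (real N * (\<delta> / ln 2)) \<le>
        real (K N) * real (card (primes_in 0 N)) - 2 * 2 ^ K N"
      using pow by linarith
    also have "\<dots> \<le> (\<Sum>k=1..K N. real (card (hits N k)))" by (rule sum_card_hits_ge)
    also have "(1 - 2 * \<delta>) * (real N / ln 2) - 2 * (real N * (\<delta> / ln 2)) = (1 - 4 * \<delta>) / ln 2 * real N"
      by (simp add: diff_divide_distrib algebra_simps)
    finally show ?case .
  qed
qed

text \<open>The bound \<open>S\<^sup>2 \<le> r (S + P)\<close> yields \<open>r \<ge> S\<^sup>2 / (S + P)\<close>, whose right-hand side increases with
  \<open>S\<close>; hence a lower bound for \<open>S\<close> alone is enough.\<close>

lemma second_moment_lower_bound: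
  fixes r S P s :: real
  assumes "S\<^sup>2 \<le> r * (S + P)" "0 < s" "s \<le> S" "0 \<le> P"
  shows "s\<^sup>2 / (s + P) \<le> r"
proof -
  have "0 \<le> S * s * (S - s) + P * (S - s) * (S + s)"
    using assms by (intro add_nonneg_nonneg mult_nonneg_nonneg) auto
  hence "s\<^sup>2 * (S + P) \<le> S\<^sup>2 * (s + P)" by (simp add: algebra_simps power2_eq_square)
  also have "\<dots> \<le> r * (S + P) * (s + P)" using assms by (intro mult_right_mono) auto
  finally have "s\<^sup>2 * (S + P) \<le> (r * (s + P)) * (S + P)" by (simp add: mult_ac)
  hence "s\<^sup>2 \<le> r * (s + P)" using assms by (subst (asm) mult_le_cancel_right) auto
  thus ?thesis using assms by (simp add: divide_le_eq)
qed

lemma card_R_lower_bound: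
  fixes \<delta> :: real
  assumes hyp: "uniform_prime_pairs_hypothesis" and \<delta>: "0 < \<delta>" "\<delta> \<le> 1 / 20"
  shows "\<forall>\<^sub>F N in sequentially.
           1 / (ln 2 + 2 * Phi N) - 11 * \<delta> / ln 2 \<le> real (card (R N)) / real N"
proof -
  have "\<delta> \<le> 1" using \<delta> by simp
  from sum_prime_pairs_count_le[OF hyp \<delta>(1) this] sum_card_hits_K_ge[OF hyp \<delta>(1) this]
    eventually_ge_at_top[of 3]
  show ?thesis
  proof eventually_elim
    case (elim N)
    have ln2: "0 < ln (2::real)" "ln (2::real) < 1" using ln_2_less_1 by auto
    define P where "P = (\<Sum>h | 1 \<le> h \<and> h \<le> K N - 1 \<and> even h. \<Sum>l=1..K N-h.
              real (prime_pairs_count (d_diff l h) (real N + 2 ^ K N)))"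
    define s where "s = (1 - 4 * \<delta>) / ln 2 * real N"
    define W where "W = ln 2 + 2 * Phi N"
    have W: "W \<ge> ln 2" "W > 0" unfolding W_def using Phi_nonneg[of N] ln2 by linarith+
    have P: "P \<ge> 0" unfolding P_def by (intro sum_nonneg) auto
    have s: "s > 0" unfolding s_def using \<delta> ln2 elim(3) by simp
    have "s\<^sup>2 / (s + 2 * P) \<le> real (card (R N))"
      by (rule second_moment_lower_bound[OF card_R_second_moment[of N "K N", folded P_def]])
         (use s P elim(2) in \<open>auto simp: s_def\<close>)
    moreover have "(1 - 11 * \<delta>) / W * real N \<le> s\<^sup>2 / (s + 2 * P)"
    proof -
      have "s + 2 * P \<le> s + 2 * ((1 + 3 * \<delta>) * (Phi N / (ln 2)\<^sup>2) * real N)"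
        using elim(1) unfolding P_def by simp
      also have "\<dots> = ((1 - 4 * \<delta>) * ln 2 + 2 * (1 + 3 * \<delta>) * Phi N) * (real N / (ln 2)\<^sup>2)"
        unfolding s_def using ln2 by (simp add: field_simps power2_eq_square)
      also have "\<dots> \<le> ((1 + 3 * \<delta>) * W) * (real N / (ln 2)\<^sup>2)"
        unfolding W_def using \<delta> ln2 by (intro mult_right_mono) (auto simp: algebra_simps)
      finally have "s + 2 * P \<le> (1 + 3 * \<delta>) * W * (real N / (ln 2)\<^sup>2)" .
      hence "s\<^sup>2 / ((1 + 3 * \<delta>) * W * (real N / (ln 2)\<^sup>2)) \<le> s\<^sup>2 / (s + 2 * P)"
        using s P W(2) \<delta> elim(3) by (intro divide_left_mono mult_pos_pos) auto
      moreover have "s\<^sup>2 / ((1 + 3 * \<delta>) * W * (real N / (ln 2)\<^sup>2)) =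
          (1 - 4 * \<delta>)\<^sup>2 / (1 + 3 * \<delta>) * (real N / W)"
      proof -
        have "(a / c * n)\<^sup>2 / (b * W * (n / c\<^sup>2)) = a\<^sup>2 / b * (n / W)" if "c > 0" "n > 0" for a b c n :: real
          using that by (simp add: power_divide power_mult_distrib) (simp add: power2_eq_square)
        thus ?thesis unfolding s_def using ln2(1) elim(3) by simp
      qed
      \<comment> \<open>With 11 the linear terms cancel: \<open>(1 - 4 * \<delta>)^2 - (1 - 11 *
        \<delta>) * (1 + 3 * \<delta>)\<close> is \<open>49 * \<delta>^2\<close>.\<close>
      moreover have "1 - 11 * \<delta> \<le> (1 - 4 * \<delta>)\<^sup>2 / (1 + 3 * \<delta>)"
        using \<delta> by (simp add: field_simps power2_eq_square)
      hence "(1 - 11 * \<delta>) * (real N / W) \<le> (1 - 4 * \<delta>)\<^sup>2 / (1 + 3 * \<delta>) * (real N / W)"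
        using W(2) by (intro mult_right_mono) auto
      ultimately show ?thesis by simp
    qed
    ultimately have "(1 - 11 * \<delta>) / W * real N \<le> real (card (R N))" by linarith
    hence "(1 - 11 * \<delta>) / W \<le> real (card (R N)) / real N"
      using elim(3) by (simp add: pos_le_divide_eq)
    \<comment> \<open>Since \<open>W \<ge> ln 2\<close>, the relative error becomes an absolute one
      that is uniform in \<open>Phi N\<close>; no upper bound for \<open>Phi\<close> is
      required.\<close>
    moreover have "11 * \<delta> / W \<le> 11 * \<delta> / ln 2"
      using W(1) \<delta> by (intro frac_le) auto
    ultimately show ?case unfolding W_def[symmetric] by (simp add: diff_divide_distrib)
  qed
qed

theorem theorem3:
  assumes "uniform_prime_pairs_hypothesis"
  shows "\<exists>\<epsilon> :: nat \<Rightarrow> real. \<epsilon> \<longlonglongrightarrow> 0 \<and>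
           (\<forall>\<^sub>F N in sequentially.
              real (card (R N)) \<ge> (1 / (ln 2 + 2 * Phi N) + \<epsilon> N) * real N)"
proof (intro exI conjI)
  \<comment> \<open>The witness is the shortfall of the density, cut off at 0 where the density
    exceeds the target. The inequality then holds by construction, and the content is that the
    shortfall tends to 0.\<close>
  define \<epsilon> where "\<epsilon> N = min 0 (real (card (R N)) / real N - 1 / (ln 2 + 2 * Phi N))" for N
  show "\<epsilon> \<longlonglongrightarrow> 0"
  proof (rule tendstoI)
    fix e :: real assume "e > 0"
    \<comment> \<open>The 12 in place of 11 makes the final error strictly less than
      \<open>e\<close>.\<close>
    define \<delta> where "\<delta> = min (1 / 20) (e * ln 2 / 12)"
    have \<delta>: "0 < \<delta>" "\<delta> \<le> 1 / 20" using \<open>e > 0\<close> by (auto simp: \<delta>_def)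
    have "11 * \<delta> \<le> 11 * (e * ln 2 / 12)" by (simp add: \<delta>_def)
    also have "\<dots> < e * ln 2" using \<open>e > 0\<close> by simp
    finally have "11 * \<delta> / ln 2 < e" by (simp add: divide_less_eq)
    from card_R_lower_bound[OF assms \<delta>] show "\<forall>\<^sub>F N in sequentially. dist (\<epsilon> N) 0 < e"
    proof eventually_elim
      case (elim N)
      thus ?case using \<open>11 * \<delta> / ln 2 < e\<close> \<open>e > 0\<close> by (auto simp: \<epsilon>_def dist_real_def min_def)
    qed
  qed
  show "\<forall>\<^sub>F N in sequentially. real (card (R N)) \<ge> (1 / (ln 2 + 2 * Phi N) + \<epsilon> N) * real N"
    using eventually_gt_at_top[of 0]
  proof eventually_elim
    case (elim N)
    have "1 / (ln 2 + 2 * Phi N) + \<epsilon> N \<le> real (card (R N)) / real N"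
      by (auto simp: \<epsilon>_def min_def)
    thus ?case using elim by (simp add: pos_le_divide_eq)
  qed
qed

end
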